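(* Let $K$ and $H$ be two regular sequence-to-function summability methods. Let $X$ and $Y$ be complex Banach spaces, and let $S:X\to Y$ and $S_n:X\to Y$ $(n\ge0)$ be bounded linear operators. Suppose that: (1) $S_n(x)\to S(x)$ as $n\to\infty$ for all $x\in W$, where $W$ is a dense subset of $X$; (2) for all $x\in X$, the sequence $(S_n(x))_{n\ge0}$ is $K$-summable to $S(x)$; (3) $K$ is scalar-included in $H$. Then, for all $x\in X$, the sequence $(S_n(x))_{n\ge0}$ is $H$-summable to $S(x)$.
   Context: A sequence-to-function summability method $K$ is given by a sequence $(k_n)_{n\ge0}$ of functions $k_n:[0,R)\to\mathbb{C}$, where $R\in(0,\infty]$; the methods $K$ and $H$ being compared are defined on the same interval $[0,R)$. For a sequence $x=(x_n)_{n\ge0}$ in a complex Banach space $Z$, its $K$-means are the formal series $K_r[x]:=\sum_{n\ge0}k_n(r)x_n$ $(r\in[0,R))$. The sequence $x$ is $K$-summable to $y\in Z$ if the series defining $K_r[x]$ converges in $Z$ for every $r\in[0,R)$ and $K_r[x]\to y$ in norm as $r\to R^-$. The method $K$ is regular if, for every complex Banach space $Z$, every convergent sequence $(x_n)$ in $Z$ is $K$-summable to $\lim_{n\to\infty}x_n$. $K$ is scalar-included in $H$ if every sequence $(x_n)_{n\ge0}$ in $\mathbb{C}$ that is $K$-summable is also $H$-summable, to the same limit. *)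

theory Defs
  imports "HOL-Analysis.Analysis" "HOL-Library.Function_Algebras"
begin

section \<open>Complex Banach spaces as a type class\<close>

class complex_banach = banach +
  fixes scaleC :: "complex \<Rightarrow> 'a \<Rightarrow> 'a"  (infixr \<open>*\<^sub>C\<close> 75)
  assumes scaleC_add_right: "a *\<^sub>C (x + y) = a *\<^sub>C x + a *\<^sub>C y"
    and scaleC_add_left: "(a + b) *\<^sub>C x = a *\<^sub>C x + b *\<^sub>C x"
    and scaleC_scaleC: "a *\<^sub>C b *\<^sub>C x = (a * b) *\<^sub>C x"
    and scaleC_of_real: "complex_of_real r *\<^sub>C x = r *\<^sub>R x"
    and norm_scaleC: "norm (a *\<^sub>C x) = cmod a * norm x"

instantiation complex :: complex_banach
begin

definition scaleC_complex :: "complex \<Rightarrow> complex \<Rightarrow> complex"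
  where "scaleC_complex a x = a * x"

instance
  by standard (simp_all add: scaleC_complex_def algebra_simps norm_mult scaleR_conv_of_real)

end

definition bounded_clinear :: "('x::complex_banach \<Rightarrow> 'y::complex_banach) \<Rightarrow> bool"
  where "bounded_clinear T \<longleftrightarrow> bounded_linear T \<and> (\<forall>c x. T (c *\<^sub>C x) = c *\<^sub>C T x)"


section \<open>Summability in a Banach space given by a type\<close>

text \<open>
  A method on \<open>[0, R)\<close> is a family \<open>k :: nat \<Rightarrow> real \<Rightarrow> complex\<close> together with
  \<open>R :: ereal\<close>; only the values \<open>k n r\<close> with \<open>0 \<le> r < R\<close> are ever used.
\<close>

definition base_interval :: "ereal \<Rightarrow> real set"
  where "base_interval R = {r. 0 \<le> r \<and> ereal r < R}"

definition to_end :: "ereal \<Rightarrow> real filter"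
  where "to_end R = (if R = \<infinity> then at_top else at_left (real_of_ereal R))"

definition K_mean :: "(nat \<Rightarrow> real \<Rightarrow> complex) \<Rightarrow> real \<Rightarrow> (nat \<Rightarrow> 'z::complex_banach) \<Rightarrow> 'z"
  where "K_mean k r x = (\<Sum>n. k n r *\<^sub>C x n)"

definition K_summable ::
    "ereal \<Rightarrow> (nat \<Rightarrow> real \<Rightarrow> complex) \<Rightarrow> (nat \<Rightarrow> 'z::complex_banach) \<Rightarrow> 'z \<Rightarrow> bool"
  where "K_summable R k x y \<longleftrightarrow>
    (\<forall>r \<in> base_interval R. summable (\<lambda>n. k n r *\<^sub>C x n)) \<and>
    ((\<lambda>r. K_mean k r x) \<longlongrightarrow> y) (to_end R)"

definition scalar_included ::
    "ereal \<Rightarrow> (nat \<Rightarrow> real \<Rightarrow> complex) \<Rightarrow> (nat \<Rightarrow> real \<Rightarrow> complex) \<Rightarrow> bool"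
  where "scalar_included R k h \<longleftrightarrow>
    (\<forall>(x :: nat \<Rightarrow> complex) y. K_summable R k x y \<longrightarrow> K_summable R h x y)"


section \<open>Regularity\<close>

text \<open>
  Regularity quantifies over all complex Banach spaces inside a hypothesis, and HOL has no
  quantifier over types. The Banach spaces ranged over are therefore triples consisting of a
  scalar multiplication, a carrier \<open>V\<close> (a linear subspace of an ambient vector
  space) and a norm \<open>N\<close> that is complete on \<open>V\<close>, not related to any topology of the
  ambient type.
\<close>

locale complex_banach_on = vector_space sc
  for sc :: "complex \<Rightarrow> 'z::ab_group_add \<Rightarrow> 'z" +
  fixes V :: "'z set" and N :: "'z \<Rightarrow> real"
  assumes subspace_V: "subspace V"
    and N_nonneg: "v \<in> V \<Longrightarrow> 0 \<le> N v"
    and N_eq_0: "v \<in> V \<Longrightarrow> N v = 0 \<longleftrightarrow> v = 0"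
    and N_scale: "v \<in> V \<Longrightarrow> N (sc c v) = cmod c * N v"
    and N_triangle: "v \<in> V \<Longrightarrow> w \<in> V \<Longrightarrow> N (v + w) \<le> N v + N w"
    and N_complete:
      "(\<And>n. s n \<in> V) \<Longrightarrow> (\<forall>e>0. \<exists>M. \<forall>m\<ge>M. \<forall>n\<ge>M. N (s m - s n) < e)
        \<Longrightarrow> \<exists>l\<in>V. (\<lambda>n. N (s n - l)) \<longlonglongrightarrow> 0"

definition K_summable_on ::
    "(complex \<Rightarrow> 'z \<Rightarrow> 'z) \<Rightarrow> 'z set \<Rightarrow> ('z \<Rightarrow> real) \<Rightarrow>
      ereal \<Rightarrow> (nat \<Rightarrow> real \<Rightarrow> complex) \<Rightarrow> (nat \<Rightarrow> 'z::ab_group_add) \<Rightarrow> 'z \<Rightarrow> bool"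
  where "K_summable_on sc V N R k x y \<longleftrightarrow>
    (\<exists>M. (\<forall>r \<in> base_interval R. M r \<in> V \<and>
           (\<lambda>m. N ((\<Sum>n<m. sc (k n r) (x n)) - M r)) \<longlonglongrightarrow> 0) \<and>
         ((\<lambda>r. N (M r - y)) \<longlongrightarrow> 0) (to_end R))"

definition scale_seq :: "complex \<Rightarrow> (nat \<Rightarrow> complex) \<Rightarrow> (nat \<Rightarrow> complex)"
  where "scale_seq c f = (\<lambda>i. c * f i)"

text \<open>
  As ambient space \<open>nat \<Rightarrow> complex\<close> suffices. Every separable complex Banach space
  has Hamel dimension at most the continuum, hence is isometrically isomorphic to some
  \<open>(V, N)\<close> with \<open>V\<close> a subspace of \<open>nat \<Rightarrow> complex\<close>, and summability of a sequence
  only involves its closed linear span. That nothing is lost is proved in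
  \<open>regular_imp_K_summable\<close> below: a regular method sums every convergent sequence in every
  complex Banach space.
\<close>

definition regular :: "ereal \<Rightarrow> (nat \<Rightarrow> real \<Rightarrow> complex) \<Rightarrow> bool"
  where "regular R k \<longleftrightarrow>
    (\<forall>V N. complex_banach_on scale_seq V N \<longrightarrow>
      (\<forall>x l. (\<forall>n. x n \<in> V) \<and> l \<in> V \<and> (\<lambda>n. N (x n - l)) \<longlonglongrightarrow> 0 \<longrightarrow>
        K_summable_on scale_seq V N R k x l))"


section \<open>The two renderings agree\<close>

lemma scaleC_zero_left [simp]: "0 *\<^sub>C x = 0"
  using scaleC_of_real[of 0 x] by simp

lemma scaleC_one [simp]: "1 *\<^sub>C x = x"
  using scaleC_of_real[of 1 x] by simp

lemma scaleC_zero_right [simp]: "a *\<^sub>C 0 = 0"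
  using scaleC_add_right[of a 0 0] by simp

lemma scaleC_diff_right: "a *\<^sub>C (x - y) = a *\<^sub>C x - a *\<^sub>C y"
  using scaleC_add_right[of a "x - y" y] by (simp add: algebra_simps)

lemma scaleC_diff_left: "(a - b) *\<^sub>C x = a *\<^sub>C x - b *\<^sub>C x"
  using scaleC_add_left[of "a - b" b x] by (simp add: algebra_simps)

lemma bounded_linear_scaleC_left: "bounded_linear (\<lambda>a. a *\<^sub>C x)"
proof (rule bounded_linear_intro[where K = "norm x"])
  fix r a
  have "(r *\<^sub>R a) *\<^sub>C x = complex_of_real r *\<^sub>C a *\<^sub>C x"
    by (simp only: scaleC_scaleC scaleR_conv_of_real)
  then show "(r *\<^sub>R a) *\<^sub>C x = r *\<^sub>R (a *\<^sub>C x)"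
    by (simp only: scaleC_of_real)
qed (simp_all add: scaleC_add_left norm_scaleC)

lemma complex_banach_on_UNIV:
  "complex_banach_on (scaleC :: complex \<Rightarrow> 'z::complex_banach \<Rightarrow> 'z) UNIV norm"
proof -
  interpret vector_space "scaleC :: complex \<Rightarrow> 'z \<Rightarrow> 'z"
    by standard (simp_all add: scaleC_add_right scaleC_add_left scaleC_scaleC)
  show ?thesis
  proof
    fix s :: "nat \<Rightarrow> 'z"
    assume "\<forall>e>0. \<exists>M. \<forall>m\<ge>M. \<forall>n\<ge>M. norm (s m - s n) < e"
    then have "Cauchy s" by (simp add: Cauchy_iff)
    then obtain l where "s \<longlonglongrightarrow> l" by (auto simp: Cauchy_convergent_iff convergent_def)
    then show "\<exists>l\<in>UNIV. (\<lambda>n. norm (s n - l)) \<longlonglongrightarrow> 0"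
      by (auto simp: LIM_zero_iff tendsto_norm_zero_iff)
  qed (simp_all add: norm_scaleC norm_triangle_ineq)
qed

lemma eventually_to_end:
  assumes "0 < R" shows "eventually (\<lambda>r. r \<in> base_interval R) (to_end R)"
proof (cases R)
  case (real a)
  then have "eventually (\<lambda>r. r \<in> {0<..<a}) (at_left a)"
    using assms by (intro eventually_at_leftI) auto
  then show ?thesis using real by (auto simp: to_end_def base_interval_def elim: eventually_mono)
next
  case PInf
  then show ?thesis by (auto simp: to_end_def base_interval_def intro: eventually_ge_at_top)
qed (use assms in auto)

lemma K_summable_on_UNIV:
  assumes "0 < R"
  shows "K_summable_on scaleC UNIV norm R k x y \<longleftrightarrow> K_summable R k x y"
proof
  assume "K_summable_on scaleC UNIV norm R k x y"
  then obtain M where M: "\<And>r. r \<in> base_interval R \<Longrightarrow> (\<lambda>n. k n r *\<^sub>C x n) sums M r"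
    and lim: "(M \<longlongrightarrow> y) (to_end R)"
    by (auto simp: K_summable_on_def sums_def tendsto_norm_zero_iff LIM_zero_iff)
  from M have *: "\<And>r. r \<in> base_interval R \<Longrightarrow> M r = K_mean k r x"
    by (simp add: K_mean_def sums_unique)
  have "((\<lambda>r. K_mean k r x) \<longlongrightarrow> y) (to_end R)"
    by (rule Lim_transform_eventually[OF lim])
       (rule eventually_mono[OF eventually_to_end[OF assms]], rule *)
  with M show "K_summable R k x y"
    by (auto simp: K_summable_def sums_iff)
next
  assume A: "K_summable R k x y"
  show "K_summable_on scaleC UNIV norm R k x y"
    unfolding K_summable_on_def
    using A
    by (intro exI[of _ "\<lambda>r. K_mean k r x"])
       (auto simp: K_summable_def K_mean_def tendsto_norm_zero_iff LIM_zero_iff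
         summable_sums_iff sums_def)
qed


text \<open>The space of absolutely summable sequences as an instance.\<close>

definition ell1 :: "(nat \<Rightarrow> complex) set"
  where "ell1 = {f. summable (\<lambda>i. cmod (f i))}"

definition ell1_norm :: "(nat \<Rightarrow> complex) \<Rightarrow> real"
  where "ell1_norm f = (\<Sum>i. cmod (f i))"

lemma vector_space_scale_seq: "vector_space scale_seq"
  by standard (auto simp: scale_seq_def fun_eq_iff algebra_simps)

lemma ell1_zero: "0 \<in> ell1"
  by (simp add: ell1_def)

lemma ell1_add: "f \<in> ell1 \<Longrightarrow> g \<in> ell1 \<Longrightarrow> f + g \<in> ell1"
  unfolding ell1_def mem_Collect_eq
  by (rule summable_comparison_test'[OF summable_add[of "\<lambda>i. cmod (f i)" "\<lambda>i. cmod (g i)"]])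
     (auto simp: norm_triangle_ineq)

lemma ell1_scale: "f \<in> ell1 \<Longrightarrow> scale_seq c f \<in> ell1"
  by (auto simp: ell1_def scale_seq_def norm_mult intro: summable_mult)

lemma ell1_diff: "f \<in> ell1 \<Longrightarrow> g \<in> ell1 \<Longrightarrow> f - g \<in> ell1"
  unfolding ell1_def mem_Collect_eq
  by (rule summable_comparison_test'[OF summable_add[of "\<lambda>i. cmod (f i)" "\<lambda>i. cmod (g i)"]])
     (auto simp: norm_triangle_ineq4)

lemma ell1_sum_le: "f \<in> ell1 \<Longrightarrow> (\<Sum>i<p. cmod (f i)) \<le> ell1_norm f"
  unfolding ell1_def ell1_norm_def by (rule sum_le_suminf) auto

lemma ell1_coord_le:
  assumes "f \<in> ell1" shows "cmod (f i) \<le> ell1_norm f"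
  using member_le_sum[of i "{..<Suc i}" "\<lambda>i. cmod (f i)"] ell1_sum_le[OF assms, of "Suc i"]
  by simp

lemma complex_banach_on_ell1: "complex_banach_on scale_seq ell1 ell1_norm"
proof -
  interpret vector_space scale_seq by (rule vector_space_scale_seq)
  show ?thesis
  proof
    show "subspace ell1"
      by (rule subspaceI) (auto simp: ell1_zero ell1_add ell1_scale)
  next
    fix f assume f: "f \<in> ell1"
    show "0 \<le> ell1_norm f"
      using f by (auto simp: ell1_def ell1_norm_def intro: suminf_nonneg)
    show "ell1_norm f = 0 \<longleftrightarrow> f = 0"
      using f by (auto simp: ell1_def ell1_norm_def suminf_eq_zero_iff fun_eq_iff)
    show "ell1_norm (scale_seq c f) = cmod c * ell1_norm f" for c
      using f by (auto simp: ell1_def ell1_norm_def scale_seq_def norm_mult suminf_mult)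
    fix g assume g: "g \<in> ell1"
    have "ell1_norm (f + g) \<le> (\<Sum>i. cmod (f i) + cmod (g i))"
      using f g ell1_add[OF f g] unfolding ell1_def ell1_norm_def
      by (intro suminf_le summable_add) (auto simp: norm_triangle_ineq)
    also have "\<dots> = ell1_norm f + ell1_norm g"
      using f g unfolding ell1_def ell1_norm_def by (subst suminf_add) auto
    finally show "ell1_norm (f + g) \<le> ell1_norm f + ell1_norm g" .
  next
    fix s :: "nat \<Rightarrow> nat \<Rightarrow> complex"
    assume s: "\<And>n. s n \<in> ell1"
      and C: "\<forall>e>0. \<exists>M. \<forall>m\<ge>M. \<forall>n\<ge>M. ell1_norm (s m - s n) < e"
    have "Cauchy (\<lambda>n. s n i)" for i
      unfolding Cauchy_iff
    proof (intro allI impI)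
      fix e :: real assume "e > 0"
      then obtain M where M: "\<forall>m\<ge>M. \<forall>n\<ge>M. ell1_norm (s m - s n) < e" using C by blast
      have "cmod (s m i - s n i) < e" if "m \<ge> M" "n \<ge> M" for m n
        using le_less_trans[OF ell1_coord_le[OF ell1_diff[OF s[of m] s[of n]], of i]] M that
        by simp
      then show "\<exists>M. \<forall>m\<ge>M. \<forall>n\<ge>M. cmod (s m i - s n i) < e" by blast
    qed
    then have "\<forall>i. \<exists>l. (\<lambda>n. s n i) \<longlonglongrightarrow> l"
      by (simp add: Cauchy_convergent_iff convergent_def)
    then obtain l where l: "\<And>i. (\<lambda>n. s n i) \<longlonglongrightarrow> l i" by metis
    have key: "s m - l \<in> ell1 \<and> ell1_norm (s m - l) \<le> e"
      if M: "\<forall>m\<ge>M. \<forall>n\<ge>M. ell1_norm (s m - s n) < e" and "m \<ge> M" for m M e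
    proof -
      have b: "(\<Sum>i<p. cmod (s m i - l i)) \<le> e" for p
      proof (rule LIMSEQ_le_const2)
        show "(\<lambda>n. \<Sum>i<p. cmod (s m i - s n i)) \<longlonglongrightarrow> (\<Sum>i<p. cmod (s m i - l i))"
          by (intro tendsto_intros l)
        have "(\<Sum>i<p. cmod (s m i - s n i)) \<le> e" if "n \<ge> M" for n
          using le_less_trans[OF ell1_sum_le[OF ell1_diff[OF s[of m] s[of n]], of p], of e]
            M that \<open>m \<ge> M\<close>
          by (simp add: less_imp_le)
        then show "\<exists>K. \<forall>n\<ge>K. (\<Sum>i<p. cmod (s m i - s n i)) \<le> e" by blast
      qed
      have sm: "summable (\<lambda>i. cmod (s m i - l i))"
        by (rule summableI_nonneg_bounded[OF _ b]) simp
      then show ?thesis using b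
        by (auto simp: ell1_def ell1_norm_def intro!: suminf_le_const)
    qed
    obtain M1 where M1: "\<forall>m\<ge>M1. \<forall>n\<ge>M1. ell1_norm (s m - s n) < 1"
      using C zero_less_one by blast
    have "s M1 - (s M1 - l) \<in> ell1"
      using key[OF M1 order_refl] ell1_diff[OF s[of M1]] by blast
    then have "l \<in> ell1" by simp
    moreover have "(\<lambda>n. ell1_norm (s n - l)) \<longlonglongrightarrow> 0"
    proof (rule LIMSEQ_I)
      fix e :: real assume "e > 0"
      then obtain M where M: "\<forall>m\<ge>M. \<forall>n\<ge>M. ell1_norm (s m - s n) < e / 2"
        using C half_gt_zero[OF \<open>e > 0\<close>] by blast
      have "norm (ell1_norm (s n - l) - 0) < e" if "n \<ge> M" for n
      proof -
        have "s n - l \<in> ell1" "ell1_norm (s n - l) \<le> e / 2" using key[OF M that] by auto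
        moreover have "0 \<le> ell1_norm (s n - l)"
          using \<open>s n - l \<in> ell1\<close> by (auto simp: ell1_def ell1_norm_def intro: suminf_nonneg)
        ultimately show ?thesis using \<open>e > 0\<close> by simp
      qed
      then show "\<exists>no. \<forall>n\<ge>no. norm (ell1_norm (s n - l) - 0) < e" by blast
    qed
    ultimately show "\<exists>l\<in>ell1. (\<lambda>n. ell1_norm (s n - l)) \<longlonglongrightarrow> 0" by blast
  qed
qed

text \<open>
  Apply regularity in \<open>ell1\<close> to the constant sequence \<open>e\<^sub>0\<close>, and to \<open>t\<^sub>n e\<^sub>n\<close>
  with \<open>t\<^sub>n = norm (x\<^sub>n - l)\<close>: the norm of the mean of the latter is
  \<open>\<Sum>\<^sub>n \<bar>k\<^sub>n(r)\<bar> t\<^sub>n\<close>.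
\<close>

definition unit_seq :: "nat \<Rightarrow> complex \<Rightarrow> nat \<Rightarrow> complex"
  where "unit_seq n c = (\<lambda>i. if i = n then c else 0)"

lemma unit_seq_ell1: "unit_seq n c \<in> ell1" and unit_seq_norm: "ell1_norm (unit_seq n c) = cmod c"
proof -
  have "(\<lambda>i. cmod (unit_seq n c i)) sums cmod c"
  proof -
    have "(\<lambda>i. cmod (unit_seq n c i)) = (\<lambda>i. if i \<in> {n} then cmod c else 0)"
      by (auto simp: unit_seq_def fun_eq_iff)
    then show ?thesis
      using sums_If_finite_set[of "{n}" "\<lambda>_. cmod c"] by simp
  qed
  then show "unit_seq n c \<in> ell1" "ell1_norm (unit_seq n c) = cmod c"
    unfolding ell1_def ell1_norm_def mem_Collect_eq by (rule sums_summable, rule sums_unique[symmetric])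
qed

lemma regular_ell1:
  assumes "regular R k" "\<And>n. x n \<in> ell1" "l \<in> ell1" "(\<lambda>n. ell1_norm (x n - l)) \<longlonglongrightarrow> 0"
  obtains M where "\<And>r. r \<in> base_interval R \<Longrightarrow> M r \<in> ell1"
    and "\<And>r i. r \<in> base_interval R \<Longrightarrow> (\<lambda>n. k n r * x n i) sums M r i"
    and "((\<lambda>r. ell1_norm (M r - l)) \<longlongrightarrow> 0) (to_end R)"
proof -
  have "K_summable_on scale_seq ell1 ell1_norm R k x l"
    using assms(1)[unfolded regular_def, rule_format, OF complex_banach_on_ell1] assms(2-4)
    by blast
  then obtain M where M: "\<And>r. r \<in> base_interval R \<Longrightarrow> M r \<in> ell1"
    "\<And>r. r \<in> base_interval R \<Longrightarrow>
      (\<lambda>m. ell1_norm ((\<Sum>n<m. scale_seq (k n r) (x n)) - M r)) \<longlonglongrightarrow> 0"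
    "((\<lambda>r. ell1_norm (M r - l)) \<longlongrightarrow> 0) (to_end R)"
    unfolding K_summable_on_def by blast
  have sum_apply: "(\<Sum>n<m. scale_seq (k n r) (x n)) i = (\<Sum>n<m. k n r * x n i)" for m r i
    by (induction m) (auto simp: scale_seq_def)
  have sum_in: "(\<Sum>n<m. scale_seq (k n r) (x n)) \<in> ell1" for m r
  proof (induction m)
    case (Suc m)
    show ?case
      unfolding sum.lessThan_Suc by (rule ell1_add[OF Suc ell1_scale[OF assms(2)]])
  qed (simp add: ell1_def)
  have "(\<lambda>n. k n r * x n i) sums M r i" if r: "r \<in> base_interval R" for r i
    unfolding sums_def
  proof (rule LIM_zero_cancel, rule Lim_null_comparison[OF _ M(2)[OF r]])
    show "\<forall>\<^sub>F m in sequentially. cmod ((\<Sum>n<m. k n r * x n i) - M r i)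
        \<le> ell1_norm ((\<Sum>n<m. scale_seq (k n r) (x n)) - M r)"
    proof (rule always_eventually, rule allI)
      fix m
      show "cmod ((\<Sum>n<m. k n r * x n i) - M r i)
          \<le> ell1_norm ((\<Sum>n<m. scale_seq (k n r) (x n)) - M r)"
        using ell1_coord_le[OF ell1_diff[OF sum_in[of r m] M(1)[OF r]], of i]
        by (simp only: minus_apply sum_apply)
    qed
  qed
  from that[OF M(1) this M(3)] show thesis by blast
qed

theorem regular_imp_K_summable:
  fixes x :: "nat \<Rightarrow> 'z::complex_banach"
  assumes "0 < R" and reg: "regular R k" and x: "x \<longlonglongrightarrow> l"
  shows "K_summable R k x l"
proof -
  define t where "t n = norm (x n - l)" for n
  have "t \<longlonglongrightarrow> 0" using tendsto_norm_zero[OF LIM_zero[OF x]] by (simp add: t_def[abs_def])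
  obtain A where A: "\<And>r i. r \<in> base_interval R \<Longrightarrow> (\<lambda>n. k n r * unit_seq 0 1 i) sums A r i"
      "\<And>r. r \<in> base_interval R \<Longrightarrow> A r \<in> ell1"
      "((\<lambda>r. ell1_norm (A r - unit_seq 0 1)) \<longlongrightarrow> 0) (to_end R)"
    by (rule regular_ell1[OF reg, of "\<lambda>_. unit_seq 0 1" "unit_seq 0 1"])
       (auto simp: unit_seq_ell1 ell1_norm_def)
  obtain B where B: "\<And>r i. r \<in> base_interval R \<Longrightarrow> (\<lambda>n. k n r * unit_seq n (t n) i) sums B r i"
      "\<And>r. r \<in> base_interval R \<Longrightarrow> B r \<in> ell1" "((\<lambda>r. ell1_norm (B r - 0)) \<longlongrightarrow> 0) (to_end R)"
    by (rule regular_ell1[OF reg, of "\<lambda>n. unit_seq n (of_real (t n))" 0])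
       (use \<open>t \<longlonglongrightarrow> 0\<close> in \<open>auto simp: unit_seq_ell1 unit_seq_norm tendsto_rabs_zero ell1_zero\<close>)
  have A0: "(\<lambda>n. k n r) sums A r 0" if "r \<in> base_interval R" for r
    using A(1)[OF that, of 0] by (simp add: unit_seq_def)
  have B0: "cmod (B r i) = cmod (k i r) * t i" if "r \<in> base_interval R" for r i
  proof -
    have "(\<lambda>n. k n r * unit_seq n (t n) i) sums (k i r * of_real (t i))"
    proof -
      have "(\<lambda>n. k n r * unit_seq n (t n) i) =
          (\<lambda>n. if n \<in> {i} then k n r * of_real (t n) else 0)"
        by (auto simp: unit_seq_def fun_eq_iff)
      then show ?thesis
        using sums_If_finite_set[of "{i}" "\<lambda>n. k n r * of_real (t n)"] by simp
    qed
    with B(1)[OF that, of i] have "B r i = k i r * of_real (t i)" by (rule sums_unique2)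
    then show ?thesis by (simp add: norm_mult t_def)
  qed
  have nrm: "norm (k n r *\<^sub>C (x n - l)) = cmod (B r n)" if "r \<in> base_interval R" for r n
    by (simp add: norm_scaleC B0[OF that] t_def)
  have sB: "summable (\<lambda>n. norm (k n r *\<^sub>C (x n - l)))" if "r \<in> base_interval R" for r
    using B(2)[OF that] by (simp add: nrm[OF that] ell1_def)
  have nB: "norm (K_mean k r (\<lambda>n. x n - l)) \<le> ell1_norm (B r)" if "r \<in> base_interval R" for r
    using summable_norm[OF sB[OF that]] by (simp add: K_mean_def nrm[OF that] ell1_norm_def)
  have dec: "(\<lambda>n. k n r *\<^sub>C x n) sums (K_mean k r (\<lambda>n. x n - l) + A r 0 *\<^sub>C l)"
    if "r \<in> base_interval R" for r
  proof -
    have "(\<lambda>n. k n r *\<^sub>C l) sums (A r 0 *\<^sub>C l)"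
      by (rule bounded_linear.sums[OF bounded_linear_scaleC_left A0[OF that]])
    from sums_add[OF summable_sums[OF summable_norm_cancel[OF sB[OF that]]] this]
    show ?thesis by (simp add: K_mean_def scaleC_diff_right)
  qed
  have ev: "eventually (\<lambda>r. r \<in> base_interval R) (to_end R)" by (rule eventually_to_end) fact
  have l1: "((\<lambda>r. K_mean k r (\<lambda>n. x n - l)) \<longlongrightarrow> 0) (to_end R)"
  proof (rule Lim_null_comparison)
    show "((\<lambda>r. ell1_norm (B r)) \<longlongrightarrow> 0) (to_end R)" using B(3) by simp
  qed (rule eventually_mono[OF ev nB])
  have "((\<lambda>r. A r 0 - 1) \<longlongrightarrow> 0) (to_end R)"
  proof (rule Lim_null_comparison[OF _ A(3)], rule eventually_mono[OF ev])
    fix r assume "r \<in> base_interval R"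
    from ell1_coord_le[OF ell1_diff[OF A(2)[OF this] unit_seq_ell1[of 0 1]], of 0]
    show "cmod (A r 0 - 1) \<le> ell1_norm (A r - unit_seq 0 1)" by (simp add: unit_seq_def)
  qed
  then have "((\<lambda>r. A r 0) \<longlongrightarrow> 1) (to_end R)" by (rule LIM_zero_cancel)
  from bounded_linear.tendsto[OF bounded_linear_scaleC_left this, of l]
  have l2: "((\<lambda>r. A r 0 *\<^sub>C l) \<longlongrightarrow> l) (to_end R)" by simp
  have "((\<lambda>r. K_mean k r x) \<longlongrightarrow> l) (to_end R)"
  proof (rule Lim_transform_eventually)
    show "((\<lambda>r. K_mean k r (\<lambda>n. x n - l) + A r 0 *\<^sub>C l) \<longlongrightarrow> l) (to_end R)"
      using tendsto_add[OF l1 l2] by simp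
    show "\<forall>\<^sub>F r in to_end R. K_mean k r (\<lambda>n. x n - l) + A r 0 *\<^sub>C l = K_mean k r x"
      by (rule eventually_mono[OF ev]) (use dec in \<open>simp add: K_mean_def sums_iff\<close>)
  qed
  with dec show ?thesis by (auto simp: K_summable_def sums_iff)
qed

end

theory Submission
  imports Defs
begin

text \<open>
  Composing with a functional on \<open>Y\<close>, scalar inclusion makes \<open>(S\<^sub>n x)\<close> weakly
  \<open>H\<close>-summable to \<open>S x\<close>. Weak convergence gives weak boundedness, hence norm boundedness, and
  so two uniform bounds by Banach-Steinhaus: on the partial sums of \<open>\<Sum>\<^sub>n h\<^sub>n(r) S\<^sub>n\<close>
  for fixed \<open>r\<close>, and on the sums themselves along every sequence of \<open>r\<close> tending to \<open>R\<close>.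
  On the dense set \<open>W\<close> both converge in norm by regularity of \<open>H\<close>, so the bounds carry
  norm convergence over to all of \<open>X\<close>. The norming functionals are real linear minorants of
  sublinear functionals; \<open>f(y) - i f(i y)\<close> makes them complex linear.
\<close>

section \<open>Norming functionals\<close>

text \<open>Homogeneity is asked as an inequality for positive factors only, which is easy to check
  for infima. Equality follows on applying it to \<open>1/t\<close> as well.\<close>

definition sublinear :: "('a::real_vector \<Rightarrow> real) \<Rightarrow> bool"
  where "sublinear q \<longleftrightarrow>
    (\<forall>x y. q (x + y) \<le> q x + q y) \<and> (\<forall>t>0. \<forall>x. q (t *\<^sub>R x) \<le> t * q x)"

lemma sublinear_add: "sublinear q \<Longrightarrow> q (x + y) \<le> q x + q y"
  by (simp add: sublinear_def)

lemma sublinear_scaleR: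
  assumes "sublinear q" "0 \<le> t"
  shows "q (t *\<^sub>R x) = t * q x"
proof (cases "t = 0")
  case True
  \<comment> \<open>Subadditivity gives \<open>q 0 >= 0\<close>; halving the vector 0 gives
    \<open>q 0 <= q 0 / 2\<close>, so \<open>q 0 <= 0\<close>.\<close>
  have "q 0 \<le> q 0 + q 0" using sublinear_add[OF assms(1), of 0 0] by simp
  moreover have "q ((1/2) *\<^sub>R 0) \<le> (1/2) * q 0"
    using assms(1) unfolding sublinear_def by (metis half_gt_zero zero_less_one)
  ultimately show ?thesis using True by simp
next
  case False
  with assms have t: "t > 0" by simp
  have "q ((1/t) *\<^sub>R (t *\<^sub>R x)) \<le> (1/t) * q (t *\<^sub>R x)"
    using assms(1) t unfolding sublinear_def by (metis zero_less_divide_1_iff)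
  with t have "t * q x \<le> q (t *\<^sub>R x)" by (simp add: field_simps)
  moreover have "q (t *\<^sub>R x) \<le> t * q x" using assms(1) t by (simp add: sublinear_def)
  ultimately show ?thesis by simp
qed

lemma sublinear_zero: "sublinear q \<Longrightarrow> q 0 = 0"
  using sublinear_scaleR[of q 0 0] by simp

lemma sublinear_lower: "sublinear q \<Longrightarrow> - q (- x) \<le> q x"
  using sublinear_add[of q x "- x"] sublinear_zero[of q] by simp

text \<open>The witness is \<open>x \<mapsto> inf\<^sub>t\<^sub>\<ge>\<^sub>0 (q (x + t a) - t q a)\<close>.\<close>

lemma sublinear_descent:
  assumes q: "sublinear q"
  obtains q' where "sublinear q'" "\<And>x. q' x \<le> q x" "\<And>x. q' x \<le> q (x + a) - q a"
proof
  define g where "g x t = q (x + t *\<^sub>R a) - t * q a" for x t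
  define q' where "q' x = (INF t\<in>{0..}. g x t)" for x
  have bdd: "bdd_below (g x ` {0..})" for x
  proof (rule bdd_belowI2)
    fix t :: real assume "t \<in> {0..}"
    \<comment> \<open>Splitting off \<open>- x\<close> gives a lower bound that does not depend on
      \<open>t\<close>.\<close>
    then have "t * q a = q ((x + t *\<^sub>R a) + (- x))" by (simp add: sublinear_scaleR[OF q])
    also have "\<dots> \<le> q (x + t *\<^sub>R a) + q (- x)" by (rule sublinear_add[OF q])
    finally show "- q (- x) \<le> g x t" by (simp add: g_def)
  qed
  have le: "q' x \<le> g x t" if "0 \<le> t" for x t
    unfolding q'_def using that by (intro cINF_lower bdd) auto
  show "q' x \<le> q x" for x using le[of 0 x] by (simp add: g_def)
  show "q' x \<le> q (x + a) - q a" for x using le[of 1 x] by (simp add: g_def)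
  show "sublinear q'"
    unfolding sublinear_def
  proof (intro conjI allI impI)
    fix x y
    \<comment> \<open>The parameters add up: \<open>g (x + y) (s + t) <= g x s + g y t\<close>. The
      infima over \<open>t\<close> and \<open>s\<close> are then taken one after the other.\<close>
    have "q' (x + y) - g x s \<le> g y t" if "0 \<le> s" "0 \<le> t" for s t
      using le[of "s + t" "x + y"] that
        sublinear_add[OF q, of "x + s *\<^sub>R a" "y + t *\<^sub>R a"]
      by (simp add: g_def algebra_simps)
    then have "q' (x + y) - g x s \<le> q' y" if "0 \<le> s" for s
      unfolding q'_def[of y] using that by (intro cINF_greatest) auto
    then have "q' (x + y) - q' y \<le> g x s" if "0 \<le> s" for s
      using that by (smt (verit))
    then have "q' (x + y) - q' y \<le> q' x"
      unfolding q'_def[of x] by (intro cINF_greatest) auto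
    then show "q' (x + y) \<le> q' x + q' y" by simp
  next
    fix t :: real and x assume t: "0 < t"
    \<comment> \<open>Rescaling the parameter along with the vector:
      \<open>g (t *\<^sub>R x) (t * s) = t * g x s\<close>.\<close>
    have "q' (t *\<^sub>R x) / t \<le> g x s" if "0 \<le> s" for s
      using le[of "t * s" "t *\<^sub>R x"] that t sublinear_scaleR[OF q, of t "x + s *\<^sub>R a"]
      by (simp add: g_def field_simps)
    then have "q' (t *\<^sub>R x) / t \<le> q' x"
      unfolding q'_def[of x] by (intro cINF_greatest) auto
    then show "q' (t *\<^sub>R x) \<le> t * q' x" using t by (simp add: field_simps)
  qed
qed

text \<open>The lower bounds needed by Zorn's lemma. The infimum is finite since
  \<open>q x >= - q (- x) >= - p (- x)\<close>. For subadditivity the smaller of two members serves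
  in both places, which is where comparability enters.\<close>

lemma sublinear_chain_INF:
  assumes C: "C \<noteq> {}" "\<And>q. q \<in> C \<Longrightarrow> sublinear q" "\<And>q. q \<in> C \<Longrightarrow> q \<le> p"
    and chain: "\<And>q q'. q \<in> C \<Longrightarrow> q' \<in> C \<Longrightarrow> q \<le> q' \<or> q' \<le> q"
  obtains u where "sublinear u" "\<And>q. q \<in> C \<Longrightarrow> u \<le> q"
proof
  define u where "u x = (INF q\<in>C. q x)" for x
  have bdd: "bdd_below ((\<lambda>q. q x) ` C)" for x
  proof (rule bdd_belowI2)
    fix q assume "q \<in> C"
    then show "- p (- x) \<le> q x"
      using sublinear_lower[OF C(2), of q x] le_funD[OF C(3), of q "- x"] by simp
  qed
  have le: "u x \<le> q x" if "q \<in> C" for x q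
    unfolding u_def using that by (intro cINF_lower bdd)
  then show "u \<le> q" if "q \<in> C" for q using that by (simp add: le_funI)
  show "sublinear u"
    unfolding sublinear_def
  proof (intro conjI allI impI)
    fix x y
    have "u (x + y) - q x \<le> q' y" if "q \<in> C" "q' \<in> C" for q q'
      using chain[OF that]
    proof
      assume "q \<le> q'"
      then show ?thesis
        using le[OF that(1), of "x + y"] sublinear_add[OF C(2)[OF that(1)], of x y]
          le_funD[of q q' y] by simp
    next
      assume "q' \<le> q"
      then show ?thesis
        using le[OF that(2), of "x + y"] sublinear_add[OF C(2)[OF that(2)], of x y]
          le_funD[of q' q x] by simp
    qed
    then have "u (x + y) - q x \<le> u y" if "q \<in> C" for q
      unfolding u_def[of y] using that C(1) by (intro cINF_greatest) auto
    then have "u (x + y) - u y \<le> q x" if "q \<in> C" for q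
      using that by (smt (verit))
    then have "u (x + y) - u y \<le> u x"
      unfolding u_def[of x] using C(1) by (intro cINF_greatest) auto
    then show "u (x + y) \<le> u x + u y" by simp
  next
    fix t :: real and x assume t: "0 < t"
    have "u (t *\<^sub>R x) / t \<le> q x" if "q \<in> C" for q
      using le[OF that, of "t *\<^sub>R x"] t sublinear_scaleR[OF C(2)[OF that], of t x]
      by (simp add: field_simps)
    then have "u (t *\<^sub>R x) / t \<le> u x"
      unfolding u_def[of x] using C(1) by (intro cINF_greatest) auto
    then show "u (t *\<^sub>R x) \<le> t * u x" using t by (simp add: field_simps)
  qed
qed

text \<open>A pointwise minimal sublinear functional is linear.\<close>

lemma linear_below_sublinear:
  assumes p: "sublinear p"
  obtains f where "linear f" "\<And>x. f x \<le> p x"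
proof -
  let ?A = "{q. sublinear q \<and> q \<le> p}"
  have "\<exists>m\<in>?A. \<forall>q\<in>?A. q \<le> m \<longrightarrow> q = m"
  proof (rule predicate_Zorn)
    \<comment> \<open>The order is reversed, so that the maximal element of Zorn's lemma is
      pointwise minimal.\<close>
    show "partial_order_on ?A (relation_of (\<lambda>f g. g \<le> f) ?A)"
      by (rule partial_order_on_relation_ofI) auto
    fix C assume "C \<in> Chains (relation_of (\<lambda>f g. g \<le> f) ?A)"
    then have C: "\<And>q q'. q \<in> C \<Longrightarrow> q' \<in> C \<Longrightarrow> q \<le> q' \<or> q' \<le> q"
      "\<And>q. q \<in> C \<Longrightarrow> sublinear q" "\<And>q. q \<in> C \<Longrightarrow> q \<le> p"
      unfolding Chains_def relation_of_def by blast+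
    show "\<exists>u\<in>?A. \<forall>q\<in>C. u \<le> q"
    proof (cases "C = {}")
      case True
      then show ?thesis using p by blast
    next
      case False
      obtain u where u: "sublinear u" "\<And>q. q \<in> C \<Longrightarrow> u \<le> q"
        using sublinear_chain_INF[OF False C(2,3,1)] by blast
      moreover from False obtain q where "q \<in> C" by blast
      ultimately have "u \<le> p" using C(3) by (meson order_trans)
      with u show ?thesis by blast
    qed
  qed
  then obtain m where m: "sublinear m" "m \<le> p"
    and min: "\<And>q. sublinear q \<Longrightarrow> q \<le> p \<Longrightarrow> q \<le> m \<Longrightarrow> q = m" by blast
  have add: "m (x + a) = m x + m a" for x a
  proof -
    \<comment> \<open>By minimality the descent of \<open>m\<close> in direction \<open>a\<close> is
      \<open>m\<close> itself, and its second bound becomes superadditivity.\<close>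
    obtain q' where q': "sublinear q'" "\<And>x. q' x \<le> m x" "\<And>x. q' x \<le> m (x + a) - m a"
      using sublinear_descent[OF m(1), of a] by blast
    then have "q' \<le> m" by (simp add: le_funI)
    then have "q' = m" using min q'(1) m(2) by (meson order_trans)
    then show ?thesis using q'(3)[of x] sublinear_add[OF m(1), of x a] by simp
  qed
  have minus: "m (- x) = - m x" for x
    using add[of x "- x"] sublinear_zero[OF m(1)] by simp
  have scale: "m (t *\<^sub>R x) = t * m x" for t x
  proof (cases "0 \<le> t")
    case True
    then show ?thesis by (rule sublinear_scaleR[OF m(1)])
  next
    case False
    then have "m ((- t) *\<^sub>R x) = (- t) * m x"
      using sublinear_scaleR[OF m(1), of "- t" x] by simp
    then show ?thesis using minus[of "t *\<^sub>R x"] by simp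
  qed
  show thesis
  proof
    show "linear m" by (rule linearI) (simp_all add: add scale)
    show "m x \<le> p x" for x using m(2) by (rule le_funD)
  qed
qed

text \<open>Descending the norm in direction \<open>a\<close> before taking a linear minorant forces
  the value at \<open>a\<close>: at \<open>- a\<close> the minorant is at most
  \<open>norm 0 - norm a\<close>, so \<open>f a >= norm a\<close>.\<close>

lemma norming_functional:
  fixes a :: "'a::real_normed_vector"
  obtains f :: "'a \<Rightarrow>\<^sub>L real" where "norm f \<le> 1" "f a = norm a"
proof -
  have "sublinear (norm :: 'a \<Rightarrow> real)"
    by (simp add: sublinear_def norm_triangle_ineq)
  then obtain p where p: "sublinear p" "\<And>x. p x \<le> norm x" "\<And>x. p x \<le> norm (x + a) - norm a"
    using sublinear_descent[of norm a] by blast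
  obtain f where f: "linear f" "\<And>x. f x \<le> p x"
    using linear_below_sublinear[OF p(1)] by blast
  have b: "norm (f x) \<le> 1 * norm x" for x
    using order_trans[OF f(2) p(2), of x] order_trans[OF f(2) p(2), of "- x"] linear_neg[OF f(1), of x]
    by simp
  then have bl: "bounded_linear f"
    using f(1) by (intro bounded_linear_intro[where K = 1])
      (auto simp: linear_add linear_scale)
  have "f a = norm a"
    using order_trans[OF f(2) p(3), of "- a"] linear_neg[OF f(1), of a] b[of a] by simp
  moreover have "norm (Blinfun f) \<le> 1"
    using b by (intro norm_blinfun_bound) (simp_all add: bounded_linear_Blinfun_apply[OF bl])
  ultimately show thesis
    using that[of "Blinfun f"] by (simp add: bounded_linear_Blinfun_apply[OF bl])
qed


section \<open>Uniform boundedness\<close>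

text \<open>By Baire category: the closed sets \<open>A n\<close>, where all \<open>T i\<close> are
  bounded by \<open>n\<close>, cover the space, so one of them contains a ball. Linearity carries
  the bound from this ball to the whole space.\<close>

theorem uniform_boundedness:
  fixes T :: "'i \<Rightarrow> 'a::banach \<Rightarrow> 'b::real_normed_vector"
  assumes T: "\<And>i. i \<in> I \<Longrightarrow> bounded_linear (T i)"
    and bdd: "\<And>x. bounded ((\<lambda>i. T i x) ` I)"
  obtains C where "0 \<le> C" "\<And>i x. i \<in> I \<Longrightarrow> norm (T i x) \<le> C * norm x"
proof -
  define A where "A n = {x. \<forall>i\<in>I. norm (T i x) \<le> real n}" for n
  have clo: "closed (A n)" for n
  proof -
    have "A n = (\<Inter>i\<in>I. {x. norm (T i x) \<le> real n})" by (auto simp: A_def)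
    also have "closed \<dots>"
      by (intro closed_INT ballI closed_Collect_le continuous_intros
          linear_continuous_on[OF T])
    finally show ?thesis .
  qed
  have "(\<Union>n. A n) = UNIV"
  proof safe
    fix x
    obtain B where B: "\<forall>i\<in>I. norm (T i x) \<le> B" using bdd[of x] by (auto simp: bounded_iff)
    obtain n where "B \<le> real n" using real_arch_simple by blast
    with B have "x \<in> A n" by (auto simp: A_def intro: order_trans)
    then show "x \<in> (\<Union>n. A n)" by blast
  qed simp
  \<comment> \<open>If all interiors were empty, Baire would give the union, which is the whole
    space, empty interior.\<close>
  moreover have "\<Union>(range A) = {}" if "\<And>n. interior (A n) = {}"
  proof -
    have "euclidean interior_of \<Union>(range A) = {}"
      using clo that
      by (intro Baire_category_alt) (auto simp: completely_metrizable_space_euclidean)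
    with \<open>(\<Union>n. A n) = UNIV\<close> show ?thesis by simp
  qed
  ultimately obtain n where "interior (A n) \<noteq> {}" by (metis UNIV_not_empty)
  then obtain z e where e: "e > 0" "cball z e \<subseteq> A n"
    by (meson all_not_in_conv mem_interior_cball)
  have "norm (T i x) \<le> 2 * real n / e * norm x" if i: "i \<in> I" for i x
  proof (cases "x = 0")
    case True
    then show ?thesis using linear_0[OF bounded_linear.linear[OF T[OF i]]] by simp
  next
    case False
    interpret bounded_linear "T i" using T[OF i] .
    \<comment> \<open>Rescaled so that \<open>z + y\<close> stays in the ball. As a difference of
      two values of norm at most \<open>n\<close>, \<open>T i y\<close> has norm at most
      \<open>2 * n\<close>.\<close>
    define y where "y = (e / norm x) *\<^sub>R x"
    have ny: "norm y = e" using False e(1) by (simp add: y_def)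
    then have "z + y \<in> A n" "z \<in> A n" using e by (auto simp: dist_norm)
    then have "norm (T i (z + y)) \<le> n" "norm (T i z) \<le> n" using i by (auto simp: A_def)
    moreover have "T i y = T i (z + y) - T i z" by (simp add: add)
    ultimately have "norm (T i y) \<le> 2 * real n"
      using norm_triangle_ineq4[of "T i (z + y)" "T i z"] by simp
    then show ?thesis using False e(1) by (simp add: y_def scaleR field_simps)
  qed
  with that[of "2 * real n / e"] e(1) show thesis by simp
qed

text \<open>The points of \<open>A\<close> act as evaluations on the dual, which is complete because
  the reals are. Uniform boundedness there bounds the evaluations, and norming functionals turn this
  into a bound on the points.\<close>

lemma bounded_if_weakly_bounded:
  fixes A :: "'a::real_normed_vector set"
  assumes "\<And>f :: 'a \<Rightarrow> real. bounded_linear f \<Longrightarrow> bounded (f ` A)"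
  shows "bounded A"
proof -
  obtain C where C: "\<And>a (f :: 'a \<Rightarrow>\<^sub>L real). a \<in> A \<Longrightarrow> norm (blinfun_apply f a) \<le> C * norm f"
    by (rule uniform_boundedness[of A "\<lambda>a (f :: 'a \<Rightarrow>\<^sub>L real). blinfun_apply f a"])
      (use assms blinfun.bounded_linear_right in
        \<open>auto intro: blinfun.bounded_linear_left\<close>)
  have "norm a \<le> \<bar>C\<bar>" if "a \<in> A" for a
  proof -
    obtain f :: "'a \<Rightarrow>\<^sub>L real" where f: "norm f \<le> 1" "f a = norm a"
      by (rule norming_functional)
    have "norm a \<le> C * norm f" using C[OF that, of f] f(2) by simp
    also have "\<dots> \<le> \<bar>C\<bar> * 1" using f(1) by (intro mult_mono) auto
    finally show ?thesis by simp
  qed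
  then show ?thesis by (auto simp: bounded_iff)
qed

lemma uniform_boundedness_weak:
  fixes T :: "'i \<Rightarrow> 'a::banach \<Rightarrow> 'b::real_normed_vector"
  assumes "\<And>i. i \<in> I \<Longrightarrow> bounded_linear (T i)"
    and "\<And>x (f :: 'b \<Rightarrow> real). bounded_linear f \<Longrightarrow> bounded ((\<lambda>i. f (T i x)) ` I)"
  obtains C where "0 \<le> C" "\<And>i x. i \<in> I \<Longrightarrow> norm (T i x) \<le> C * norm x"
proof -
  have "bounded ((\<lambda>i. T i x) ` I)" for x
    by (rule bounded_if_weakly_bounded) (simp add: image_image assms(2))
  from uniform_boundedness[OF assms(1) this] that show thesis by metis
qed

section \<open>Norm convergence from a dense set and uniform bounds\<close>

lemma norm_add_diff_le:
  fixes a b c :: "'a::real_normed_vector"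
  shows "norm (a + b - c) \<le> norm a + norm b + norm c"
  using norm_triangle_ineq4[of "a + b" c] norm_triangle_ineq[of a b] by linarith

text \<open>Approximate \<open>x\<close> by some \<open>w\<close> in \<open>W\<close>; the bounds
  \<open>C\<close> and \<open>D\<close> control the error before and after the limit. Linearity and
  the bound are asked only eventually, since the means are known to be operators only inside the
  base interval.\<close>

lemma tendsto_from_dense:
  fixes T :: "'i \<Rightarrow> 'a::real_normed_vector \<Rightarrow> 'b::real_normed_vector"
  assumes T: "eventually (\<lambda>i. linear (T i) \<and> (\<forall>x. norm (T i x) \<le> C * norm x)) F"
    and S: "bounded_linear S" and W: "closure W = UNIV" and C: "0 \<le> C"
    and lim: "\<And>w. w \<in> W \<Longrightarrow> ((\<lambda>i. T i w) \<longlongrightarrow> S w) F"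
  shows "((\<lambda>i. T i x) \<longlongrightarrow> S x) F"
proof (rule tendstoI)
  fix e :: real assume e: "e > 0"
  obtain D where D: "D > 0" "\<And>x. norm (S x) \<le> D * norm x"
    using bounded_linear.pos_bounded[OF S] by (metis mult.commute)
  \<comment> \<open>Chosen so that \<open>(C + D) * d = e / 2\<close>; the denominator is positive
    even for \<open>C = 0\<close> because \<open>D > 0\<close>.\<close>
  define d where "d = e / (2 * (C + D))"
  have d: "d > 0" using e C D(1) by (simp add: d_def)
  then obtain w where w: "w \<in> W" "dist w x < d"
    using W closure_approachable[of x W] by auto
  have "eventually (\<lambda>i. dist (T i w) (S w) < e / 2) F"
    using tendstoD[OF lim[OF w(1)], of "e / 2"] e by simp
  then show "eventually (\<lambda>i. dist (T i x) (S x) < e) F"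
    using T
  proof eventually_elim
    case (elim i)
    have "T i x - S x = T i (x - w) + (T i w - S w) - S (x - w)"
      using elim(2) bounded_linear.linear[OF S] by (simp add: linear_diff)
    then have "norm (T i x - S x) \<le> norm (T i (x - w)) + norm (T i w - S w) + norm (S (x - w))"
      by (simp only: norm_add_diff_le)
    also have "\<dots> < C * norm (x - w) + e / 2 + D * norm (x - w)"
      using elim D(2)[of "x - w"] by (smt (verit) dist_norm)
    also have "\<dots> \<le> (C + D) * d + e / 2"
      using w(2) C D(1) by (simp add: dist_norm norm_minus_commute mult_left_mono flip: distrib_right)
    also have "\<dots> = e" using C D(1) by (simp add: d_def field_simps)
    finally show ?case by (simp add: dist_norm)
  qed
qed

text \<open>No limit operator is at hand here, so the approximation shows the Cauchy property and
  completeness of the target supplies the limit.\<close>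

lemma convergent_from_dense:
  fixes T :: "nat \<Rightarrow> 'a::real_normed_vector \<Rightarrow> 'b::banach"
  assumes T: "\<And>m. linear (T m)" "\<And>m x. norm (T m x) \<le> C * norm x"
    and W: "closure W = UNIV" and C: "0 \<le> C"
    and lim: "\<And>w. w \<in> W \<Longrightarrow> convergent (\<lambda>m. T m w)"
  shows "convergent (\<lambda>m. T m x)"
  unfolding Cauchy_convergent_iff[symmetric]
proof (rule CauchyI)
  fix e :: real assume e: "e > 0"
  \<comment> \<open>\<open>C + 1\<close> keeps the denominator positive when \<open>C = 0\<close>.
    The two outer terms are at most \<open>e / 3\<close> and the middle one is strictly smaller, so
    the sum is below \<open>e\<close>.\<close>
  define d where "d = e / (3 * (C + 1))"
  have d: "d > 0" using e C by (simp add: d_def)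
  then obtain w where w: "w \<in> W" "dist w x < d"
    using W closure_approachable[of x W] by auto
  have "C * norm (x - w) \<le> (C + 1) * d"
    using w(2) C by (intro mult_mono) (auto simp: dist_norm norm_minus_commute)
  also have "\<dots> = e / 3" using C by (simp add: d_def field_simps)
  finally have small: "norm (T m (x - w)) \<le> e / 3" for m using T(2) order_trans by blast
  obtain M where M: "\<And>m n. m \<ge> M \<Longrightarrow> n \<ge> M \<Longrightarrow> norm (T m w - T n w) < e / 3"
    using CauchyD[OF convergent_Cauchy[OF lim[OF w(1)]], of "e / 3"] e by auto
  have "norm (T m x - T n x) < e" if "m \<ge> M" "n \<ge> M" for m n
  proof -
    have "T m x - T n x = T m (x - w) + (T m w - T n w) - T n (x - w)"
      by (simp add: linear_diff[OF T(1)])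
    then have "norm (T m x - T n x) \<le>
        norm (T m (x - w)) + norm (T m w - T n w) + norm (T n (x - w))"
      by (simp only: norm_add_diff_le)
    with small[of m] small[of n] M[OF that] show ?thesis by linarith
  qed
  then show "\<exists>M. \<forall>m\<ge>M. \<forall>n\<ge>M. norm (T m x - T n x) < e" by blast
qed


section \<open>Summability and functionals\<close>

text \<open>For use with uniform boundedness: a function with a limit at the end is bounded only on
  a neighbourhood depending on that function, whereas a convergent sequence is bounded
  outright.\<close>

lemma to_end_sequentially:
  fixes f :: "real \<Rightarrow> 'a::first_countable_topology"
  assumes "0 < R" and seq: "\<And>X. filterlim X (to_end R) sequentially \<Longrightarrow> (\<lambda>n. f (X n)) \<longlonglongrightarrow> l"
  shows "(f \<longlongrightarrow> l) (to_end R)"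
proof (cases R)
  case (real a)
  then have "0 < a" using assms(1) by simp
  then have "(f \<longlongrightarrow> l) (at_left a)"
  proof (rule tendsto_at_left_sequentially)
    fix X assume "\<And>n. X n < a" "X \<longlonglongrightarrow> a"
    then have "filterlim X (at_left a) sequentially"
      by (auto simp: filterlim_at less_imp_neq)
    then show "(\<lambda>n. f (X n)) \<longlonglongrightarrow> l" using seq real by (simp add: to_end_def)
  qed
  then show ?thesis using real by (simp add: to_end_def)
next
  case PInf
  then show ?thesis using seq tendsto_at_topI_sequentially[of f l] by (simp add: to_end_def)
qed (use assms(1) in auto)

text \<open>Weak boundedness is tested with real functionals, but a mean with complex coefficients
  commutes only with complex linear ones. Taking real parts leads back to \<open>f\<close>.\<close>

lemma bounded_clinear_complexify:
  fixes f :: "'y::complex_banach \<Rightarrow> real"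
  assumes f: "bounded_linear f"
  obtains g :: "'y \<Rightarrow> complex" where "bounded_clinear g" "\<And>y. Re (g y) = f y"
proof -
  let ?g = "\<lambda>y. Complex (f y) (- f (\<i> *\<^sub>C y))"
  interpret f: bounded_linear f by fact
  have iscale: "\<i> *\<^sub>C (r *\<^sub>R y) = r *\<^sub>R (\<i> *\<^sub>C y)" for r and y :: 'y
  proof -
    have "\<i> *\<^sub>C complex_of_real r *\<^sub>C y = complex_of_real r *\<^sub>C \<i> *\<^sub>C y"
      by (simp only: scaleC_scaleC mult.commute)
    then show ?thesis by (simp only: scaleC_of_real)
  qed
  obtain K where K: "\<And>y. norm (f y) \<le> norm y * K" using f.bounded by blast
  have "bounded_linear ?g"
  proof (rule bounded_linear_intro)
    show "?g (x + y) = ?g x + ?g y" for x y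
      by (simp add: complex_eq_iff f.add scaleC_add_right)
    show "?g (r *\<^sub>R x) = r *\<^sub>R ?g x" for r x
      by (simp add: complex_eq_iff f.scaleR iscale)
    \<comment> \<open>Real and imaginary part each contribute \<open>K\<close>, as
      \<open>\<i> *\<^sub>C y\<close> has the norm of \<open>y\<close>.\<close>
    show "norm (?g y) \<le> norm y * (2 * K)" for y
      using cmod_le[of "?g y"] K[of y] K[of "\<i> *\<^sub>C y"] by (simp add: norm_scaleC)
  qed
  moreover have "?g (c *\<^sub>C y) = c *\<^sub>C ?g y" for c y
  proof -
    have eq: "c *\<^sub>C y = Re c *\<^sub>R y + Im c *\<^sub>R (\<i> *\<^sub>C y)"
    proof -
      have "c = complex_of_real (Re c) + complex_of_real (Im c) * \<i>"
        by (simp add: complex_eq_iff)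
      then have "c *\<^sub>C y = (complex_of_real (Re c) + complex_of_real (Im c) * \<i>) *\<^sub>C y"
        by (rule arg_cong)
      also have "\<dots> = Re c *\<^sub>R y + Im c *\<^sub>R (\<i> *\<^sub>C y)"
        by (simp only: scaleC_add_left scaleC_of_real flip: scaleC_scaleC)
      finally show ?thesis .
    qed
    have ii: "\<i> *\<^sub>C \<i> *\<^sub>C y = - y"
      using scaleC_of_real[of "-1" y] by (simp add: scaleC_scaleC)
    have "\<i> *\<^sub>C c *\<^sub>C y = Re c *\<^sub>R (\<i> *\<^sub>C y) - Im c *\<^sub>R y"
      by (simp add: eq scaleC_add_right iscale ii)
    then show ?thesis
      by (simp add: complex_eq_iff scaleC_complex_def eq f.add f.diff f.scaleR)
  qed
  ultimately show thesis using that[of ?g] by (simp add: bounded_clinear_def)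
qed

lemma sums_bounded_clinear:
  assumes "bounded_clinear g" "summable (\<lambda>n. k n r *\<^sub>C x n)"
  shows "(\<lambda>n. k n r *\<^sub>C g (x n)) sums g (K_mean k r x)"
proof -
  have "(\<lambda>n. g (k n r *\<^sub>C x n)) sums g (K_mean k r x)"
    using assms(1) bounded_linear.sums[OF _ summable_sums[OF assms(2)], of g]
    by (simp add: bounded_clinear_def K_mean_def)
  with assms(1) show ?thesis by (simp add: bounded_clinear_def)
qed

lemma K_summable_bounded_clinear:
  assumes R: "0 < R" and g: "bounded_clinear g" and x: "K_summable R k x l"
  shows "K_summable R k (\<lambda>n. g (x n)) (g l)"
proof -
  have bl: "bounded_linear g" using g by (simp add: bounded_clinear_def)
  have s: "(\<lambda>n. k n r *\<^sub>C g (x n)) sums g (K_mean k r x)" if "r \<in> base_interval R" for r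
    using sums_bounded_clinear[OF g] x that by (simp add: K_summable_def)
  have "((\<lambda>r. g (K_mean k r x)) \<longlongrightarrow> g l) (to_end R)"
    using bounded_linear.tendsto[OF bl] x by (auto simp: K_summable_def)
  then have "((\<lambda>r. K_mean k r (\<lambda>n. g (x n))) \<longlongrightarrow> g l) (to_end R)"
    by (rule Lim_transform_eventually, intro eventually_mono[OF eventually_to_end[OF R]])
      (use s in \<open>simp add: K_mean_def sums_iff\<close>)
  with s show ?thesis by (auto simp: K_summable_def sums_iff)
qed

section \<open>From scalar inclusion to summability of operator orbits\<close>

theorem theorem5p1:
  fixes k h :: "nat \<Rightarrow> real \<Rightarrow> complex" and R :: ereal
    and S :: "'x::complex_banach \<Rightarrow> 'y::complex_banach"
    and Sn :: "nat \<Rightarrow> 'x \<Rightarrow> 'y"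
    and W :: "'x set"
  assumes "0 < R"
    and "regular R k" and "regular R h"
    and "bounded_clinear S" and "\<And>n. bounded_clinear (Sn n)"
    and "closure W = UNIV"
    and "\<And>w. w \<in> W \<Longrightarrow> (\<lambda>n. Sn n w) \<longlonglongrightarrow> S w"
    and "\<And>x. K_summable R k (\<lambda>n. Sn n x) (S x)"
    and "scalar_included R k h"
  shows "\<forall>x. K_summable R h (\<lambda>n. Sn n x) (S x)"
proof -
  let ?I = "base_interval R"
  define T where "T r m x = (\<Sum>n<m. h n r *\<^sub>C Sn n x)" for r m x
  have S: "bounded_linear S" using assms(4) by (simp add: bounded_clinear_def)
  have Tbl: "bounded_linear (T r m)" for r m
  proof -
    have "bounded_linear (\<lambda>y. c *\<^sub>C y :: 'y)" for c
      by (rule bounded_linear_intro[where K = "cmod c"])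
        (simp_all add: scaleC_add_right norm_scaleC scaleC_scaleC mult.commute flip: scaleC_of_real)
    then show ?thesis
      using assms(5) unfolding T_def bounded_clinear_def
      by (intro bounded_linear_sum) (auto intro: bounded_linear_compose)
  qed
  \<comment> \<open>A functional turns the orbit into a complex \<open>k\<close>-summable sequence,
    to which scalar inclusion applies.\<close>
  have scalar: "K_summable R h (\<lambda>n. g (Sn n x)) (g (S x))"
    if "bounded_clinear g" for g :: "'y \<Rightarrow> complex" and x
    using assms(9) K_summable_bounded_clinear[OF assms(1) that assms(8)]
    unfolding scalar_included_def by blast
  have onW: "K_summable R h (\<lambda>n. Sn n w) (S w)" if "w \<in> W" for w
    by (rule regular_imp_K_summable[OF assms(1,3) assms(7)[OF that]])
  have weak: "convergent (\<lambda>m. f (T r m x))"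
    if f: "bounded_linear f" and r: "r \<in> ?I" for f :: "'y \<Rightarrow> real" and r x
  proof -
    obtain g :: "'y \<Rightarrow> complex" where g: "bounded_clinear g" "\<And>y. Re (g y) = f y"
      using bounded_clinear_complexify[OF f] by blast
    have bl: "bounded_linear g" and gs: "\<And>c y. g (c *\<^sub>C y) = c *\<^sub>C g y"
      using g(1) by (auto simp: bounded_clinear_def)
    have "summable (\<lambda>n. h n r *\<^sub>C g (Sn n x))"
      using scalar[OF g(1), of x] r unfolding K_summable_def by blast
    then have "convergent (\<lambda>m. g (T r m x))"
      by (simp add: summable_iff_convergent T_def linear_sum[OF bounded_linear.linear[OF bl]] gs)
    then obtain L where "(\<lambda>m. g (T r m x)) \<longlonglongrightarrow> L" by (auto simp: convergent_def)
    from tendsto_Re[OF this] show ?thesis by (auto simp: convergent_def g(2))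
  qed
  \<comment> \<open>First use of Banach-Steinhaus: \<open>r\<close> is fixed and \<open>m\<close>
    varies. It yields existence of the means on the whole space, without saying how \<open>C\<close>
    depends on \<open>r\<close>.\<close>
  have conv: "\<exists>C\<ge>0. \<forall>m x. norm (T r m x) \<le> C * norm x"
    and summ: "convergent (\<lambda>m. T r m x)" if r: "r \<in> ?I" for r x
  proof -
    have "bounded (range (\<lambda>m. f (T r m x)))" if "bounded_linear f" for f :: "'y \<Rightarrow> real" and x
      using weak[OF that r, of x] convergent_imp_bounded unfolding convergent_def by blast
    then obtain C where C: "0 \<le> C" "\<And>m x. norm (T r m x) \<le> C * norm x"
      using uniform_boundedness_weak[of UNIV "T r"] Tbl by (metis UNIV_I)
    then show "\<exists>C\<ge>0. \<forall>m x. norm (T r m x) \<le> C * norm x" by blast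
    have "convergent (\<lambda>m. T r m w)" if "w \<in> W" for w
      using onW[OF that] r unfolding K_summable_def summable_iff_convergent T_def by blast
    then show "convergent (\<lambda>m. T r m x)"
      by (rule convergent_from_dense[OF bounded_linear.linear[OF Tbl] C(2) assms(6) C(1)])
  qed
  define U where "U r x = K_mean h r (\<lambda>n. Sn n x)" for r x
  have sm: "summable (\<lambda>n. h n r *\<^sub>C Sn n x)" if "r \<in> ?I" for r x
    using summ[OF that, of x] by (simp only: summable_iff_convergent T_def)
  have lim: "(\<lambda>m. T r m x) \<longlonglongrightarrow> U r x" if "r \<in> ?I" for r x
    using summable_LIMSEQ[OF sm[OF that, of x]] by (simp only: T_def U_def K_mean_def)
  have Ubl: "bounded_linear (U r)" if r: "r \<in> ?I" for r
  proof -
    obtain C where C: "\<And>m x. norm (T r m x) \<le> C * norm x" using conv[OF r] by blast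
    show ?thesis
    proof (rule bounded_linear_intro)
      fix x y and c :: real
      have "(\<lambda>m. T r m (x + y)) \<longlonglongrightarrow> U r x + U r y"
        using tendsto_add[OF lim[OF r, of x] lim[OF r, of y]]
        by (simp add: linear_add[OF bounded_linear.linear[OF Tbl]])
      then show "U r (x + y) = U r x + U r y" using lim[OF r] LIMSEQ_unique by blast
      have "(\<lambda>m. T r m (c *\<^sub>R x)) \<longlonglongrightarrow> c *\<^sub>R U r x"
        using tendsto_scaleR[OF tendsto_const lim[OF r, of x]]
        by (simp add: linear_scale[OF bounded_linear.linear[OF Tbl]])
      then show "U r (c *\<^sub>R x) = c *\<^sub>R U r x" using lim[OF r] LIMSEQ_unique by blast
      show "norm (U r x) \<le> norm x * C"
        by (rule LIMSEQ_le_const2[OF tendsto_norm[OF lim[OF r]]])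
          (use C in \<open>auto simp: mult.commute\<close>)
    qed
  qed
  \<comment> \<open>The means tend weakly to \<open>S x\<close>; this supplies the boundedness for
    the second use of Banach-Steinhaus.\<close>
  have Uweak: "((\<lambda>r. f (U r x)) \<longlongrightarrow> f (S x)) (to_end R)"
    if f: "bounded_linear f" for f :: "'y \<Rightarrow> real" and x
  proof -
    obtain g :: "'y \<Rightarrow> complex" where g: "bounded_clinear g" "\<And>y. Re (g y) = f y"
      using bounded_clinear_complexify[OF f] by blast
    have "((\<lambda>r. K_mean h r (\<lambda>n. g (Sn n x))) \<longlongrightarrow> g (S x)) (to_end R)"
      using scalar[OF g(1), of x] unfolding K_summable_def by blast
    moreover have "K_mean h r (\<lambda>n. g (Sn n x)) = g (U r x)" if "r \<in> ?I" for r
      using sums_bounded_clinear[where k = h and x = "\<lambda>n. Sn n x", OF g(1) sm[OF that]]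
      by (simp add: K_mean_def U_def sums_iff)
    ultimately have "((\<lambda>r. g (U r x)) \<longlongrightarrow> g (S x)) (to_end R)"
      by (rule Lim_transform_eventually[OF _ eventually_mono[OF eventually_to_end[OF assms(1)]]])
    from tendsto_Re[OF this] show ?thesis by (simp add: g(2))
  qed
  have "((\<lambda>r. U r x) \<longlongrightarrow> S x) (to_end R)" for x
  proof (rule to_end_sequentially[OF assms(1)])
    fix X assume X: "filterlim X (to_end R) sequentially"
    have ev: "eventually (\<lambda>j. X j \<in> ?I) sequentially"
      by (rule eventually_compose_filterlim[OF eventually_to_end[OF assms(1)] X])
    \<comment> \<open>Early terms of \<open>X\<close> may lie outside the base interval, where
      \<open>U\<close> is not known to be bounded linear. The index set leaves them out.\<close>
    have "bounded ((\<lambda>j. f (U (X j) x)) ` {j. X j \<in> ?I})"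
      if "bounded_linear f" for f :: "'y \<Rightarrow> real" and x
      using convergent_imp_bounded[OF filterlim_compose[OF Uweak[OF that] X]]
      by (rule bounded_subset) auto
    then obtain C where C: "0 \<le> C" "\<And>j x. X j \<in> ?I \<Longrightarrow> norm (U (X j) x) \<le> C * norm x"
      using uniform_boundedness_weak[of "{j. X j \<in> ?I}" "\<lambda>j. U (X j)"] Ubl
      by (metis mem_Collect_eq)
    show "(\<lambda>j. U (X j) x) \<longlonglongrightarrow> S x"
    proof (rule tendsto_from_dense[OF _ S assms(6) C(1)])
      show "eventually (\<lambda>j. linear (U (X j)) \<and> (\<forall>x. norm (U (X j) x) \<le> C * norm x)) sequentially"
        using ev by eventually_elim (use C(2) Ubl bounded_linear.linear in blast)
      fix w assume "w \<in> W"
      then have "((\<lambda>r. U r w) \<longlongrightarrow> S w) (to_end R)"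
        using onW unfolding K_summable_def U_def by blast
      then show "(\<lambda>j. U (X j) w) \<longlonglongrightarrow> S w" using X by (rule filterlim_compose)
    qed
  qed
  with sm show ?thesis unfolding K_summable_def U_def by blast
qed

end
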